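(* Let $\mathcal{H}_u$ be a separable Hilbert space equipped with the Gaussian measure $\mu_0=\mathcal{N}(0,\mathcal{C}_0)$ and let $\mathcal{H}$ be the Cameron-Martin space of $\mu_0$. For $n=1,\ldots,N$ let $u_n,w_n\in\mathcal{H}_u$, $b_n\in\mathbb{R}$, $h(x)=\tanh(x)$, and $$f_{\theta_n}^{(n)}(u)=u+\mathcal{F}_{\theta_n}^{(n)}(u),\qquad \mathcal{F}_{\theta_n}^{(n)}(u)=u_n\,h\big(\langle w_n,u\rangle_{\mathcal{H}_u}+b_n\big),\qquad u\in\mathcal{H}_u .$$ Assume that for all $n=1,\ldots,N$: $w_n,u_n\in\mathcal{H}$ and $\langle u_n,w_n\rangle_{\mathcal{H}_u}>-1$. Then for all $n=1,\ldots,N$: (1) $\mathrm{Im}(\mathcal{F}_{\theta_n}^{(n)})\subset\mathcal{H}$; (2) $\mathcal{F}_{\theta_n}^{(n)}$ has finite dimensional range; (3) $f_{\theta_n}^{(n)}:\mathcal{H}_u\to\mathcal{H}_u$ is bijective; (4) for any $u\in\mathcal{H}_u$, no element of the point spectrum of the Fréchet derivative $D\mathcal{F}_{\theta_n}^{(n)}(u)$ lies in $(-\infty,-1]$.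
   Context: "Finite dimensional range" means the image is contained in a finite-dimensional linear subspace. The parameters of the layer are $\theta_n=\{u_n,w_n,b_n\}$. The Cameron-Martin space $\mathcal{H}\subset\mathcal{H}_u$ of $\mathcal{N}(0,\mathcal{C}_0)$ carries the inner product $\langle u,v\rangle_{\mathcal{H}}=\langle\mathcal{C}_0^{-1/2}u,\mathcal{C}_0^{-1/2}v\rangle_{\mathcal{H}_u}$. *)

theory Defs
  imports "HOL-Probability.Probability"
begin

definition self_adjoint_nonneg :: "('a::real_inner \<Rightarrow>\<^sub>L 'a) \<Rightarrow> bool" where
  "self_adjoint_nonneg A \<longleftrightarrow> (\<forall>x y. A x \<bullet> y = x \<bullet> A y) \<and> (\<forall>x. 0 \<le> A x \<bullet> x)"

(* The variance-0 case is the Dirac measure: a Gaussian measure on a Hilbert space may be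
   degenerate, and every marginal along the kernel of the covariance is. *)
definition normal_law :: "real \<Rightarrow> real \<Rightarrow> real measure" where
  "normal_law m v =
     (if v = 0 then return borel m else density lborel (\<lambda>x. ennreal (normal_density m (sqrt v) x)))"

(* M = N(m, C): a Borel probability measure all of whose one-dimensional marginals are Gaussian,
   with mean vector m and covariance operator C. That C is trace class follows from the
   existence of M. *)
definition gaussian_measure ::
    "'a::{real_inner, second_countable_topology} \<Rightarrow> ('a \<Rightarrow>\<^sub>L 'a) \<Rightarrow> 'a measure \<Rightarrow> bool" where
  "gaussian_measure m C M \<longleftrightarrow>
     self_adjoint_nonneg C \<and> prob_space M \<and> sets M = sets borel \<and>
     (\<forall>w. distr M borel (\<lambda>x. w \<bullet> x) = normal_law (w \<bullet> m) (C w \<bullet> w))"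

(* On a Hilbert space the nonnegative square root of a nonnegative self-adjoint bounded
   operator exists and is unique. *)
definition op_sqrt :: "('a::real_inner \<Rightarrow>\<^sub>L 'a) \<Rightarrow> ('a \<Rightarrow>\<^sub>L 'a)" where
  "op_sqrt C = (THE S. self_adjoint_nonneg S \<and> S o\<^sub>L S = C)"

(* The underlying vector space of the Cameron-Martin space of N(0, C): the domain of C^{-1/2},
   that is, the range of C^{1/2}. *)
definition cameron_martin_space :: "('a::real_inner \<Rightarrow>\<^sub>L 'a) \<Rightarrow> 'a set" where
  "cameron_martin_space C = range (blinfun_apply (op_sqrt C))"

definition planar_residual :: "'a::real_inner \<Rightarrow> 'a \<Rightarrow> real \<Rightarrow> 'a \<Rightarrow> 'a" where
  "planar_residual u w b x = tanh (w \<bullet> x + b) *\<^sub>R u"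

definition planar_layer :: "'a::real_inner \<Rightarrow> 'a \<Rightarrow> real \<Rightarrow> 'a \<Rightarrow> 'a" where
  "planar_layer u w b x = x + planar_residual u w b x"

definition finite_dim_subspace :: "'a::real_vector set \<Rightarrow> bool" where
  "finite_dim_subspace V \<longleftrightarrow> (\<exists>B. finite B \<and> V = span B)"

definition has_finite_dim_range :: "('b \<Rightarrow> 'a::real_vector) \<Rightarrow> bool" where
  "has_finite_dim_range F \<longleftrightarrow> (\<exists>V. finite_dim_subspace V \<and> range F \<subseteq> V)"

(* Real eigenvalues only. A real number is an eigenvalue of the complexification of T exactly
   when it is one of T, so nothing is lost when intersecting with subsets of the real line. *)
definition point_spectrum :: "('a::real_vector \<Rightarrow> 'a) \<Rightarrow> real set" where
  "point_spectrum T = {c. \<exists>v. v \<noteq> 0 \<and> T v = c *\<^sub>R v}"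

end

theory Submission
  imports Defs
begin

text \<open>
  Put a = u \<bullet> w. Pairing x + tanh (w \<bullet> x + b) u = y with w turns it into the scalar equation
  s + a tanh (s + b) = w \<bullet> y for s = w \<bullet> x, and a solution s of the scalar equation gives back
  x = y - tanh (s + b) u. The scalar function is strictly increasing because its derivative
  1 + a (1 - tanh (s + b)^2) is positive for a > -1, and it is onto because it differs from
  the identity by a bounded term. The derivative of the residual has rank at most one, and its
  only possible nonzero eigenvalue is a (1 - tanh (w \<bullet> x + b)^2), which exceeds -1.
\<close>

lemma tanh_deriv_bounds:
  fixes x :: real
  shows "0 < 1 - (tanh x)\<^sup>2" "1 - (tanh x)\<^sup>2 \<le> 1"
  using tanh_real_bounds[of x] by (auto simp: abs_square_less_1)

text \<open>For negative \<open>a\<close>, a factor in (0, 1] only moves the value towards 0. With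
  \<open>k\<close> a derivative of \<open>tanh\<close>, this gives both monotonicity and the
  eigenvalue bound.\<close>

lemma mult_unit_interval_gt_neg_one:
  fixes a k :: real
  assumes "a > -1" "0 < k" "k \<le> 1"
  shows "a * k > -1"
proof (cases "a \<ge> 0")
  case True
  then have "0 \<le> a * k" using assms by simp
  then show ?thesis by linarith
next
  case False
  then have "a * 1 \<le> a * k"
    using assms by (intro mult_left_mono_neg) auto
  then show ?thesis using assms(1) by simp
qed

lemma bij_add_mult_tanh:
  fixes a b :: real
  assumes "a > -1"
  shows "bij (\<lambda>s. s + a * tanh (s + b))"
proof (rule bijI)
  let ?g = "\<lambda>s. s + a * tanh (s + b)"
  have deriv: "(?g has_real_derivative 1 + a * (1 - (tanh (s + b))\<^sup>2)) (at s)" for s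
    by (auto intro!: derivative_eq_intros)
  have pos: "0 < 1 + a * (1 - (tanh (s + b))\<^sup>2)" for s
    using mult_unit_interval_gt_neg_one[OF assms tanh_deriv_bounds[of "s + b"]] by linarith
  have "?g s < ?g t" if "s < t" for s t
    by (rule DERIV_pos_imp_increasing[OF that]) (use deriv pos in blast)
  then have "strict_mono ?g" by (rule strict_monoI)
  then show "inj ?g" by (rule strict_mono_imp_inj_on)
  show "surj ?g"
    unfolding surj_def
  proof
    fix t
    have bound: "\<bar>a * tanh x\<bar> \<le> \<bar>a\<bar>" for x
      unfolding abs_mult using tanh_real_bounds[of x]
      by (intro mult_left_le) auto
    \<comment> \<open>The perturbation of the identity has size at most
      \<open>\<bar>a\<bar>\<close>, so stepping that far to either side of \<open>t\<close> brackets
      the value \<open>t\<close>.\<close>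
    have "\<exists>s\<ge>t - \<bar>a\<bar>. s \<le> t + \<bar>a\<bar> \<and> ?g s = t"
    proof (rule IVT)
      show "?g (t - \<bar>a\<bar>) \<le> t" using bound[of "t - \<bar>a\<bar> + b"] by linarith
      show "t \<le> ?g (t + \<bar>a\<bar>)" using bound[of "t + \<bar>a\<bar> + b"] by linarith
    qed (use deriv DERIV_isCont in auto)
    then show "\<exists>s. t = ?g s" by auto
  qed
qed

text \<open>All values are multiples of \<open>u\<close>, and the range of a linear operator is
  closed under scaling.\<close>

lemma range_planar_residual_subset_cameron_martin_space:
  assumes "u \<in> cameron_martin_space C"
  shows "range (planar_residual u w b) \<subseteq> cameron_martin_space C"
proof -
  obtain y where "u = op_sqrt C y"
    using assms by (auto simp: cameron_martin_space_def)
  then have "planar_residual u w b x = op_sqrt C (tanh (w \<bullet> x + b) *\<^sub>R y)" for x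
    by (simp add: planar_residual_def blinfun.scaleR_right)
  then show ?thesis
    by (auto simp: cameron_martin_space_def)
qed

lemma has_finite_dim_range_planar_residual: "has_finite_dim_range (planar_residual u w b)"
proof -
  have "range (planar_residual u w b) \<subseteq> span {u}"
    by (auto simp: planar_residual_def intro: span_scale span_base)
  then show ?thesis
    unfolding has_finite_dim_range_def finite_dim_subspace_def
    by (intro exI[of _ "span {u}"] conjI exI[of _ "{u}"]) auto
qed

lemma bij_planar_layer:
  assumes "u \<bullet> w > -1"
  shows "bij (planar_layer u w b)"
proof -
  let ?g = "\<lambda>s. s + (u \<bullet> w) * tanh (s + b)"
  have g: "bij ?g" using assms by (rule bij_add_mult_tanh)
  have w_layer: "w \<bullet> planar_layer u w b x = ?g (w \<bullet> x)" for x
    by (simp add: planar_layer_def planar_residual_def inner_add_right inner_commute)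
  show ?thesis
  proof (rule bijI)
    show "inj (planar_layer u w b)"
    proof (rule injI)
      fix x y assume eq: "planar_layer u w b x = planar_layer u w b y"
      then have "?g (w \<bullet> x) = ?g (w \<bullet> y)" using w_layer by metis
      then have "w \<bullet> x = w \<bullet> y" using bij_is_inj[OF g] by (rule injD[rotated])
      \<comment> \<open>The residual sees its argument only through the pairing with
        \<open>w\<close>, so the two residuals cancel.\<close>
      with eq show "x = y" by (simp add: planar_layer_def planar_residual_def)
    qed
    show "surj (planar_layer u w b)"
      unfolding surj_def
    proof
      fix y
      obtain s where s: "w \<bullet> y = ?g s" using bij_is_surj[OF g] by (rule surjE)
      \<comment> \<open>By the choice of \<open>s\<close>, the candidate preimage has pairing
        \<open>s\<close> with \<open>w\<close>, so its residual is exactly the term subtracted from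
        \<open>y\<close>.\<close>
      have "w \<bullet> (y - tanh (s + b) *\<^sub>R u) = s"
        by (simp add: inner_diff_right s inner_commute[of w u])
      then have "planar_layer u w b (y - tanh (s + b) *\<^sub>R u) = y"
        by (simp add: planar_layer_def planar_residual_def)
      then show "\<exists>x. y = planar_layer u w b x" by metis
    qed
  qed
qed

lemma has_derivative_planar_residual:
  "(planar_residual u w b has_derivative
     (\<lambda>v. ((1 - (tanh (w \<bullet> x + b))\<^sup>2) * (w \<bullet> v)) *\<^sub>R u)) (at x)"
proof -
  have "((\<lambda>x. w \<bullet> x + b) has_derivative (\<lambda>v. w \<bullet> v)) (at x)"
    by (auto intro!: derivative_eq_intros)
  moreover have "(tanh has_derivative (*) (1 - (tanh (w \<bullet> x + b))\<^sup>2)) (at (w \<bullet> x + b))"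
    unfolding has_field_derivative_def[symmetric]
    by (auto intro!: derivative_eq_intros)
  ultimately have "((\<lambda>x. tanh (w \<bullet> x + b)) has_derivative
      (\<lambda>v. (1 - (tanh (w \<bullet> x + b))\<^sup>2) * (w \<bullet> v))) (at x)"
    by (rule has_derivative_compose)
  then show ?thesis
    unfolding planar_residual_def by (rule has_derivative_scaleR_left)
qed

text \<open>Pair the eigenvalue equation with \<open>w\<close> and cancel
  \<open>w \<bullet> v\<close>, which cannot vanish: otherwise \<open>c *\<^sub>R v\<close> would be
  0.\<close>

lemma nonzero_eigenvalue_rank_one:
  assumes "c \<in> point_spectrum (\<lambda>v. (k * (w \<bullet> v)) *\<^sub>R u)" "c \<noteq> 0"
  shows "c = (u \<bullet> w) * k"
proof -
  obtain v where v: "v \<noteq> 0" "(k * (w \<bullet> v)) *\<^sub>R u = c *\<^sub>R v"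
    using assms(1) by (auto simp: point_spectrum_def)
  then have "w \<bullet> v \<noteq> 0" using assms(2) by auto
  moreover have "k * (w \<bullet> v) * (w \<bullet> u) = c * (w \<bullet> v)"
    using arg_cong[OF v(2), of "\<lambda>z. w \<bullet> z"] by simp
  ultimately show ?thesis by (simp add: inner_commute mult.commute)
qed

lemma point_spectrum_planar_residual:
  assumes "u \<bullet> w > -1"
  shows "point_spectrum (frechet_derivative (planar_residual u w b) (at x)) \<inter> {..-1} = {}"
proof -
  let ?k = "1 - (tanh (w \<bullet> x + b))\<^sup>2"
  have "frechet_derivative (planar_residual u w b) (at x) = (\<lambda>v. (?k * (w \<bullet> v)) *\<^sub>R u)"
    \<comment> \<open>\<open>frechet_derivative\<close> is a choice; uniqueness of derivatives
      identifies it with the rank-one map.\<close>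
    using frechet_derivative_at[OF has_derivative_planar_residual] by metis
  moreover have "(u \<bullet> w) * ?k > -1"
    by (rule mult_unit_interval_gt_neg_one[OF assms tanh_deriv_bounds])
  ultimately show ?thesis
    \<comment> \<open>An eigenvalue in \<open>{..-1}\<close> is nonzero, hence equal to
      \<open>(u \<bullet> w) * ?k\<close>, which exceeds -1.\<close>
    using nonzero_eigenvalue_rank_one[of _ ?k w u] by fastforce
qed

text \<open>The sort \<open>{real_inner, polish_space}\<close> encodes a separable real Hilbert
  space. Differentiability is asserted with the spectral claim, since
  \<open>frechet_derivative\<close> is meaningful only where a derivative exists.\<close>

theorem theorem2p6:
  fixes \<mu>0 :: "'a::{real_inner, polish_space} measure"
    and C0 :: "'a \<Rightarrow>\<^sub>L 'a"
    and N :: nat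
    and u w :: "nat \<Rightarrow> 'a"
    and b :: "nat \<Rightarrow> real"
  assumes "gaussian_measure 0 C0 \<mu>0"
    and "\<And>n. n \<in> {1..N} \<Longrightarrow> w n \<in> cameron_martin_space C0"
    and "\<And>n. n \<in> {1..N} \<Longrightarrow> u n \<in> cameron_martin_space C0"
    and "\<And>n. n \<in> {1..N} \<Longrightarrow> u n \<bullet> w n > -1"
  shows "\<forall>n\<in>{1..N}.
      range (planar_residual (u n) (w n) (b n)) \<subseteq> cameron_martin_space C0 \<and>
      has_finite_dim_range (planar_residual (u n) (w n) (b n)) \<and>
      bij (planar_layer (u n) (w n) (b n)) \<and>
      (\<forall>x. planar_residual (u n) (w n) (b n) differentiable (at x) \<and>
           point_spectrum (frechet_derivative (planar_residual (u n) (w n) (b n)) (at x))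
             \<inter> {..-1} = {})"
  using assms(3,4)
  by (simp add: range_planar_residual_subset_cameron_martin_space
      has_finite_dim_range_planar_residual bij_planar_layer point_spectrum_planar_residual
      differentiableI[OF has_derivative_planar_residual])

end
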